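(* Let $m\ge2$, $n\ge1$ and $\mathcal{A}\in T_{m,n}$, and let $\mathcal{A}^+=(b_{i_1\cdots i_m})\in T_{m,n}$ be given by $b_{i_1\cdots i_m}=a_{i_1\cdots i_m}-r_{i_1}^+$. Then $\mathcal{A}$ is a $B$-tensor if and only if $\mathcal{A}^+$ is strictly diagonally dominated.
   Context: $[n]=\{1,\dots,n\}$. $T_{m,n}$ is the set of real $m$th order $n$-dimensional tensors $\mathcal{A}=(a_{i_1\cdots i_m})$, $i_1,\dots,i_m\in[n]$. For $i\in[n]$, $r_i^+=\max\{0,\,a_{ij_2\cdots j_m}:(j_2,\dots,j_m)\ne(i,\dots,i)\}$. A tensor $\mathcal{A}=(a_{i_1\cdots i_m})\in T_{m,n}$ is a $B$-tensor if for all $i\in[n]$, $\sum_{i_2,\dots,i_m=1}^n a_{ii_2\cdots i_m}>0$ and $\frac{1}{n^{m-1}}\sum_{i_2,\dots,i_m=1}^n a_{ii_2\cdots i_m}>a_{ij_2\cdots j_m}$ for all $(j_2,\dots,j_m)\ne(i,\dots,i)$. A tensor $\mathcal{B}=(b_{i_1\cdots i_m})$ is strictly diagonally dominated if for all $i\in[n]$, $b_{ii\cdots i}>\sum_{(i_2,\dots,i_m)\ne(i,\dots,i)}|b_{ii_2\cdots i_m}|$ (no absolute value on the diagonal entry). *)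

theory Defs
  imports Complex_Main "HOL-Library.FuncSet"
begin

text \<open>An index tuple over \<open>[n] = {1..n}\<close> is a list, so the entry with indices
  \<open>i, i\<^sub>2, \<dots>, i\<^sub>m\<close> of an order \<open>m\<close> tensor \<open>A\<close> is \<open>A (i # js)\<close> with \<open>js\<close> of length \<open>m - 1\<close>.\<close>

definition idx :: "nat \<Rightarrow> nat \<Rightarrow> nat list set" where
  "idx k n = {js. length js = k \<and> set js \<subseteq> {1..n}}"

lemma finite_idx: "finite (idx k n)"
proof -
  have "idx k n = {js. set js \<subseteq> {1..n} \<and> length js = k}"
    by (auto simp: idx_def)
  then show ?thesis
    by (simp add: finite_lists_length_eq)
qed

definition tensors :: "nat \<Rightarrow> nat \<Rightarrow> (nat list \<Rightarrow> real) set" where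
  "tensors m n = (idx m n \<rightarrow>\<^sub>E UNIV)"

text \<open>The tuples \<open>(j\<^sub>2, \<dots>, j\<^sub>m) \<noteq> (i, \<dots>, i)\<close>.\<close>

definition offdiag :: "nat \<Rightarrow> nat \<Rightarrow> nat \<Rightarrow> nat list set" where
  "offdiag m n i = idx (m - 1) n - {replicate (m - 1) i}"

definition r_plus :: "nat \<Rightarrow> nat \<Rightarrow> (nat list \<Rightarrow> real) \<Rightarrow> nat \<Rightarrow> real" where
  "r_plus m n A i = Max (insert 0 ((\<lambda>js. A (i # js)) ` offdiag m n i))"

definition A_plus :: "nat \<Rightarrow> nat \<Rightarrow> (nat list \<Rightarrow> real) \<Rightarrow> nat list \<Rightarrow> real" where
  "A_plus m n A = (\<lambda>is \<in> idx m n. A is - r_plus m n A (hd is))"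

lemma A_plus_in_tensors: "A_plus m n A \<in> tensors m n"
  by (simp add: A_plus_def tensors_def)

definition B_tensor :: "nat \<Rightarrow> nat \<Rightarrow> (nat list \<Rightarrow> real) \<Rightarrow> bool" where
  "B_tensor m n A \<longleftrightarrow>
    (\<forall>i\<in>{1..n}.
      (\<Sum>js\<in>idx (m - 1) n. A (i # js)) > 0 \<and>
      (\<forall>js\<in>offdiag m n i.
        1 / real n ^ (m - 1) * (\<Sum>ks\<in>idx (m - 1) n. A (i # ks)) > A (i # js)))"

definition strictly_diag_dominated :: "nat \<Rightarrow> nat \<Rightarrow> (nat list \<Rightarrow> real) \<Rightarrow> bool" where
  "strictly_diag_dominated m n B \<longleftrightarrow>
    (\<forall>i\<in>{1..n}. B (replicate m i) > (\<Sum>js\<in>offdiag m n i. \<bar>B (i # js)\<bar>))"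

end

(* Entries of A^+ off the diagonal are nonpositive, so row i of A^+ is dominated by its diagonal
   entry iff its sum is positive, i.e. iff the i-th row sum of A exceeds n^(m-1) * r_i^+; since
   r_i^+ is the maximum of 0 and the off-diagonal entries, this is the B-tensor condition. *)

theory Submission imports Defs begin

lemma card_idx: "card (idx k n) = n ^ k"
proof -
  have "idx k n = {js. set js \<subseteq> {1..n} \<and> length js = k}"
    by (auto simp: idx_def)
  then show ?thesis
    by (simp add: card_lists_length_eq)
qed

lemma replicate_in_idx: "i \<in> {1..n} \<Longrightarrow> replicate k i \<in> idx k n"
  by (auto simp: idx_def)

lemma Cons_in_idx:
  assumes "i \<in> {1..n}" and "js \<in> idx (m - 1) n" and "m \<ge> 1"
  shows "i # js \<in> idx m n"
  using assms by (auto simp: idx_def)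

lemma finite_offdiag: "finite (offdiag m n i)"
  by (simp add: offdiag_def finite_idx)

text \<open>A finite maximum lies below x exactly when all its members do. The inserted 0 yields
  \<open>0 < x\<close>, so both B-tensor conditions on a row merge into one strict
  inequality.\<close>

lemma r_plus_less_iff:
  "r_plus m n A i < x \<longleftrightarrow> 0 < x \<and> (\<forall>js\<in>offdiag m n i. A (i # js) < x)"
  by (simp add: r_plus_def finite_offdiag)

lemma r_plus_ge: "js \<in> offdiag m n i \<Longrightarrow> A (i # js) \<le> r_plus m n A i"
  by (simp add: r_plus_def finite_offdiag)

text \<open>\<open>A_plus\<close> is restricted to \<open>idx m n\<close> and takes the value
  \<open>undefined\<close> elsewhere, hence the conditions on i, js and m.\<close>

lemma A_plus_Cons:
  assumes "i \<in> {1..n}" and "js \<in> idx (m - 1) n" and "m \<ge> 1"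
  shows "A_plus m n A (i # js) = A (i # js) - r_plus m n A i"
  using Cons_in_idx[OF assms] by (simp add: A_plus_def)

text \<open>The shift is constant along row i, which has n^(m-1) entries.\<close>

lemma A_plus_row_sum:
  assumes "i \<in> {1..n}" and "m \<ge> 1"
  shows "(\<Sum>js\<in>idx (m - 1) n. A_plus m n A (i # js)) =
    (\<Sum>js\<in>idx (m - 1) n. A (i # js)) - real n ^ (m - 1) * r_plus m n A i"
  using assms by (simp add: A_plus_Cons sum_subtractf card_idx)

lemma A_plus_row_dominated_iff:
  assumes i: "i \<in> {1..n}" and m: "m \<ge> 1"
  shows "(\<Sum>js\<in>offdiag m n i. \<bar>A_plus m n A (i # js)\<bar>) < A_plus m n A (replicate m i) \<longleftrightarrow>
    0 < (\<Sum>js\<in>idx (m - 1) n. A_plus m n A (i # js))"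
proof -
  have "\<bar>A_plus m n A (i # js)\<bar> = - A_plus m n A (i # js)" if "js \<in> offdiag m n i" for js
  proof -
    have "js \<in> idx (m - 1) n"
      using that by (simp add: offdiag_def)
    then show ?thesis
      using r_plus_ge[OF that, of A] by (simp add: A_plus_Cons[OF i _ m])
  qed
  then have "(\<Sum>js\<in>offdiag m n i. \<bar>A_plus m n A (i # js)\<bar>) =
      - (\<Sum>js\<in>offdiag m n i. A_plus m n A (i # js))"
    by (simp add: sum_negf)
  moreover have "replicate m i = i # replicate (m - 1) i"
    using m by (cases m) auto
  \<comment> \<open>With the diagonal entry split off, the row sum is precisely the diagonal entry
    minus the sum of absolute values, so one is positive iff the other is.\<close>
  moreover have "(\<Sum>js\<in>idx (m - 1) n. A_plus m n A (i # js)) =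
      A_plus m n A (i # replicate (m - 1) i) + (\<Sum>js\<in>offdiag m n i. A_plus m n A (i # js))"
    unfolding offdiag_def by (rule sum.remove[OF finite_idx replicate_in_idx[OF i]])
  ultimately show ?thesis
    by auto
qed

theorem corollary1:
  fixes m n :: nat and A :: "nat list \<Rightarrow> real"
  assumes "m \<ge> 2" and "n \<ge> 1" and "A \<in> tensors m n"
  shows "B_tensor m n A \<longleftrightarrow> strictly_diag_dominated m n (A_plus m n A)"
proof -
  have "(0 < (\<Sum>js\<in>idx (m - 1) n. A (i # js)) \<and>
      (\<forall>js\<in>offdiag m n i. A (i # js) < 1 / real n ^ (m - 1) * (\<Sum>ks\<in>idx (m - 1) n. A (i # ks))))
    \<longleftrightarrow> (\<Sum>js\<in>offdiag m n i. \<bar>A_plus m n A (i # js)\<bar>) < A_plus m n A (replicate m i)"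
    (is "0 < ?S \<and> ?off \<longleftrightarrow> ?dom") if i: "i \<in> {1..n}" for i
  proof -
    have m: "m \<ge> 1" and N: "real n ^ (m - 1) > 0"
      using assms by auto
    \<comment> \<open>\<open>r_plus_less_iff\<close> is applied with x the mean of row i; as n^(m-1)
      > 0, the mean is positive iff the row sum is.\<close>
    have "0 < ?S \<and> ?off \<longleftrightarrow> r_plus m n A i < 1 / real n ^ (m - 1) * ?S"
      using N by (simp add: r_plus_less_iff zero_less_divide_iff)
    also have "\<dots> \<longleftrightarrow> 0 < ?S - real n ^ (m - 1) * r_plus m n A i"
      using N by (simp add: field_simps)
    also have "\<dots> \<longleftrightarrow> ?dom"
      by (simp only: A_plus_row_dominated_iff[OF i m] A_plus_row_sum[OF i m])
    finally show ?thesis .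
  qed
  then show ?thesis
    unfolding B_tensor_def strictly_diag_dominated_def by (intro ball_cong) auto
qed

end
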